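(* Let $A:X\to Y$ be an injective bounded linear operator with non-closed range between two Hilbert spaces $X$ and $Y$, and let $\{X_\nu\}$ be the variable Hilbert scale generated by $T=(A^*A)^{-1}$. Let $\chi$ and $\Psi$ be index functions, with $\Psi$ concave, such that $\Psi(\chi(\lambda)\,\lambda)\ge\lambda$ for all $\|T^{-1}\|^{-1}\le\lambda<\infty$, and let $$\lim_{\lambda\to\infty}\frac{\Psi(\lambda)}{\lambda}=0 .$$ Let $Af=g$ with $f\in B_\chi(R_1)$, $R_1>0$. Let $\delta_{max}>0$ be prescribed, and suppose that for every $\delta\in(0,\delta_{max}]$ and every $g^\delta\in Y$ with $\|g-g^\delta\|\le\delta$, the regularised solution $f_\alpha$, with the regularisation parameter $\alpha=\alpha(\delta)$ or $\alpha=\alpha(\delta,g^\delta)$ attributed to $\delta$ and $g^\delta$, satisfies $f_\alpha\in B_\chi(R_2)$, where $R_2>0$, and $$\|Af_\alpha-g\|\le\bar C\,\bar\xi(\delta),\qquad 0<\delta\le\delta_{max},$$ for some rate function $\bar\xi$ and some constant $\bar C>0$ ($R_2$, $\bar\xi$ and $\bar C$ not depending on $\delta$ and $g^\delta$). Then $$\|f-f_\alpha\|\le\bar C\,\bar\xi(\delta)\sqrt{\Psi\left(\left[\frac{R_1+R_2}{\bar C\,\bar\xi(\delta)}\right]^2\right)},\qquad 0<\delta\le\delta_{max},$$ where the upper bound on the right-hand side is a rate function (of $\delta$), i.e. it tends to zero as $\delta\to0$.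
   Context: $X$ and $Y$ are infinite dimensional separable Hilbert spaces, with norms denoted $\|\cdot\|$. An index function is a continuous function $(0,\infty)\to(0,\infty)$. A rate function is an index function $\bar\theta$ that is monotonically increasing (non-strictly) with $\lim_{t\to+0}\bar\theta(t)=0$; a function on a finite interval $(0,t_0]$ with these properties is also regarded as a rate function, since it can be extended to $(0,\infty)$. For an index function $\nu$, $X_\nu$ is the closure (completion) of the domain of the quadratic form $\|h\|_\nu^2=(h,\nu(T)h)$, with norm $\|\cdot\|_\nu$ ($\nu(T)$ defined by the spectral calculus). The ball is $B_\chi(R)=\{h\in X_\chi:\ \|h\|_\chi\le R\}$. The $f_\alpha\in X$ are approximations of $f$ computed from $g^\delta$ by a regularisation method with parameter $\alpha>0$. *)

theory Defs
  imports "HOL-Analysis.Analysis"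
begin

text \<open>
  Hilbert spaces are complete real inner product spaces. This includes the complex case: a
  complex Hilbert space with the real part of its inner product is a real Hilbert space with the
  same norm, and adjoints and spectral measures are the same.
\<close>

definition infinite_dimensional :: "'a::real_vector itself \<Rightarrow> bool" where
  "infinite_dimensional _ \<longleftrightarrow> \<not> (\<exists>B::'a set. finite B \<and> span B = UNIV)"


subsection \<open>Spectral calculus\<close>

definition projection_valued_measure :: "(real set \<Rightarrow> 'a::real_inner \<Rightarrow> 'a) \<Rightarrow> bool" where
  "projection_valued_measure E \<longleftrightarrow>
     (\<forall>B\<in>sets borel. bounded_linear (E B) \<and> (\<forall>x y. E B x \<bullet> y = x \<bullet> E B y)) \<and>
     (\<forall>x. E UNIV x = x) \<and>
     (\<forall>B\<in>sets borel. \<forall>C\<in>sets borel. \<forall>x. E (B \<inter> C) x = E B (E C x)) \<and>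
     (\<forall>B::nat \<Rightarrow> real set. range B \<subseteq> sets borel \<longrightarrow> disjoint_family B \<longrightarrow>
        (\<forall>x. (\<lambda>n. E (B n) x) sums E (\<Union>n. B n) x))"

definition scalar_measure :: "(real set \<Rightarrow> 'a::real_inner \<Rightarrow> 'a) \<Rightarrow> 'a \<Rightarrow> real measure" where
  "scalar_measure E x = measure_of UNIV (sets borel) (\<lambda>B. ennreal (E B x \<bullet> x))"

definition spectral_domain :: "(real set \<Rightarrow> 'a::real_inner \<Rightarrow> 'a) \<Rightarrow> (real \<Rightarrow> real) \<Rightarrow> 'a set" where
  "spectral_domain E \<phi> = {x. integrable (scalar_measure E x) (\<lambda>t. (\<phi> t)\<^sup>2)}"

text \<open>
  Possibly unbounded operators are given by their graphs. The operator
  \<open>\<integral> \<phi> dE\<close> is determined on its (dense) domain by its bilinear form, which is obtained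
  from the scalar measures by polarisation.
\<close>

definition spectral_integral ::
    "(real set \<Rightarrow> 'a::real_inner \<Rightarrow> 'a) \<Rightarrow> (real \<Rightarrow> real) \<Rightarrow> ('a \<times> 'a) set" where
  "spectral_integral E \<phi> = {(x, y). x \<in> spectral_domain E \<phi> \<and>
     (\<forall>z\<in>spectral_domain E \<phi>. y \<bullet> z =
        ((\<integral>t. \<phi> t \<partial>scalar_measure E (x + z)) - (\<integral>t. \<phi> t \<partial>scalar_measure E (x - z))) / 4)}"

definition is_spectral_measure ::
    "('a::real_inner \<times> 'a) set \<Rightarrow> (real set \<Rightarrow> 'a \<Rightarrow> 'a) \<Rightarrow> bool" where
  "is_spectral_measure T E \<longleftrightarrow> projection_valued_measure E \<and> T = spectral_integral E (\<lambda>t. t)"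

text \<open>
  \<open>has_form_value T \<nu> h q\<close> says that \<open>h\<close> lies in the domain of the quadratic form of
  \<open>\<nu>(T)\<close> and that \<open>(h, \<nu>(T) h) = q\<close>. By the spectral theorem a self-adjoint \<open>T\<close> has a
  spectral measure, unique on Borel sets. The functions \<open>\<nu>\<close> of interest live on the positive
  half-line, which carries the spectral measure when \<open>T\<close> is strictly positive.
\<close>

definition has_form_value ::
    "('a::real_inner \<times> 'a) set \<Rightarrow> (real \<Rightarrow> real) \<Rightarrow> 'a \<Rightarrow> real \<Rightarrow> bool" where
  "has_form_value T \<nu> h q \<longleftrightarrow> (\<exists>E. is_spectral_measure T E \<and>
     set_integrable (scalar_measure E h) {0<..} \<nu> \<and>
     q = (LINT t:{0<..}|scalar_measure E h. \<nu> t))"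


subsection \<open>Variable Hilbert scales\<close>

text \<open>
  \<open>scale_space T \<nu>\<close> is the part of \<open>X\<^sub>\<nu>\<close> lying in the original Hilbert space, that is, the
  domain of the quadratic form. If \<open>\<nu>\<close> is bounded away from zero on the spectrum of \<open>T\<close>, the
  form domain is already complete and is all of \<open>X\<^sub>\<nu>\<close>; otherwise the completion also contains
  ideal elements outside the original space.
\<close>

definition scale_space :: "('a::real_inner \<times> 'a) set \<Rightarrow> (real \<Rightarrow> real) \<Rightarrow> 'a set" where
  "scale_space T \<nu> = {h. \<exists>q. has_form_value T \<nu> h q}"

definition scale_norm :: "('a::real_inner \<times> 'a) set \<Rightarrow> (real \<Rightarrow> real) \<Rightarrow> 'a \<Rightarrow> real" where
  "scale_norm T \<nu> h = sqrt (THE q. has_form_value T \<nu> h q)"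

definition scale_ball :: "('a::real_inner \<times> 'a) set \<Rightarrow> (real \<Rightarrow> real) \<Rightarrow> real \<Rightarrow> 'a set" where
  "scale_ball T \<nu> R = {h \<in> scale_space T \<nu>. scale_norm T \<nu> h \<le> R}"

text \<open>The graph of \<open>T = (A\<^sup>* A)\<^sup>-\<^sup>1\<close>, whose domain is the range of \<open>A\<^sup>* A\<close>.\<close>

definition scale_generator :: "('a::real_inner \<Rightarrow> 'b::real_inner) \<Rightarrow> ('a \<times> 'a) set" where
  "scale_generator A = {(adjoint A (A y), y) | y. True}"


subsection \<open>Index and rate functions\<close>

definition index_function :: "(real \<Rightarrow> real) \<Rightarrow> bool" where
  "index_function \<phi> \<longleftrightarrow> continuous_on {0<..} \<phi> \<and> (\<forall>t>0. 0 < \<phi> t)"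

text \<open>Here \<open>I\<close> is either the positive half-line or an interval \<open>{0<..t}\<close>.\<close>

definition rate_function_on :: "real set \<Rightarrow> (real \<Rightarrow> real) \<Rightarrow> bool" where
  "rate_function_on I \<theta> \<longleftrightarrow> continuous_on I \<theta> \<and> (\<forall>t\<in>I. 0 < \<theta> t) \<and> mono_on I \<theta> \<and>
     (\<theta> \<longlongrightarrow> 0) (at_right 0)"

end

theory Submission
  imports Defs
begin

text \<open>
  With \<open>S = A\<^sup>* A\<close> and \<open>\<mu>\<close> the spectral measure of \<open>h = f - f\<^sub>\<alpha>\<close>, one has \<open>\<integral> d\<mu> = \<parallel>h\<parallel>\<^sup>2\<close>,
  \<open>\<integral> t\<^sup>-\<^sup>1 d\<mu> = \<parallel>A h\<parallel>\<^sup>2\<close> and \<open>\<integral> \<chi> d\<mu> \<le> (R\<^sub>1 + R\<^sub>2)\<^sup>2\<close>, and Jensen's inequality for the concave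
  \<open>\<Psi>\<close> and the measure \<open>t\<^sup>-\<^sup>1 d\<mu>\<close> interpolates between them. The bound tends to zero because it equals
  \<open>(R\<^sub>1 + R\<^sub>2) (\<Psi>(u) / u)\<^sup>1\<^sup>/\<^sup>2\<close> with \<open>u \<rightarrow> \<infinity>\<close>, and \<open>\<Psi>(u) / u\<close> is decreasing.

  The scale norm is a definite description over all spectral measures of \<open>T\<close>, so it is meaningful
  only once these are shown to have the same scalar measures: the range of \<open>E [a, \<infinity>)\<close> consists of
  the \<open>x\<close> with \<open>a\<^sup>k \<parallel>S\<^sup>k x\<parallel> \<le> \<parallel>x\<parallel>\<close> for all \<open>k\<close>. The operators are reached through the graph of \<open>T\<close>
  alone: comparing forms shows that \<open>E\<close> commutes with \<open>S\<close>.
\<close>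

subsection \<open>Adjoints on Hilbert spaces\<close>

text \<open>Variational proof: a minimiser of \<open>J\<close> represents \<open>F\<close>, and
  completeness supplies one because the parallelogram law makes minimising sequences Cauchy.\<close>

lemma riesz_representation:
  fixes F :: "'a::{real_inner, banach} \<Rightarrow> real"
  assumes F: "bounded_linear F"
  obtains z where "\<And>x. F x = x \<bullet> z"
proof -
  interpret F: bounded_linear F by (rule F)
  define J where "J x = (norm x)\<^sup>2 - 2 * F x" for x
  define d where "d = Inf (range J)"
  obtain K where K: "\<And>x. \<bar>F x\<bar> \<le> norm x * K" using F.bounded by auto
  have J_bound: "- K\<^sup>2 \<le> J x" for x
    using K[of x] sum_squares_ge_zero[of "norm x - K" 0] unfolding J_def
    by (simp add: power2_eq_square algebra_simps abs_le_iff)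
  have bdd: "bdd_below (range J)"
    by (rule bdd_belowI2[of _ "- K\<^sup>2"]) (rule J_bound)
  have d_le: "d \<le> J x" for x
    unfolding d_def by (rule cINF_lower[OF bdd]) simp
  have near: "\<exists>x. J x < d + inverse (Suc n)" for n
  proof -
    have "Inf (range J) < d + inverse (real (Suc n))" unfolding d_def by simp
    then show ?thesis using cInf_less_iff[OF _ bdd] by auto
  qed
  then obtain X where X: "\<And>n. J (X n) < d + inverse (Suc n)" by metis
  \<comment> \<open>The midpoint of \<open>x\<close> and \<open>y\<close> also has
    \<open>J\<close>-value at least \<open>d\<close>, which turns the parallelogram law into a bound
    on the distance.\<close>
  have par: "(norm (x - y))\<^sup>2 \<le> 2 * (J x - d) + 2 * (J y - d)" for x y
  proof -
    have "4 * J ((1/2) *\<^sub>R (x + y)) + (norm (x - y))\<^sup>2 = 2 * J x + 2 * J y"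
      unfolding J_def F.scaleR F.add power2_norm_eq_inner
      by (simp add: inner_add_left inner_add_right inner_diff_left inner_diff_right algebra_simps inner_commute)
    then show ?thesis using d_le[of "(1/2) *\<^sub>R (x + y)"] by simp
  qed
  have inv_lim: "(\<lambda>n. inverse (real (Suc n))) \<longlonglongrightarrow> 0"
    by (rule LIMSEQ_inverse_real_of_nat)
  have "Cauchy X"
  proof (rule metric_CauchyI)
    fix e :: real assume "0 < e"
    then have "0 < e\<^sup>2 / 4" by simp
    from order_tendstoD(2)[OF inv_lim this] obtain N where
      N: "\<And>n. n \<ge> N \<Longrightarrow> inverse (real (Suc n)) < e\<^sup>2 / 4"
      by (auto simp: eventually_sequentially)
    have "dist (X m) (X n) < e" if "m \<ge> N" "n \<ge> N" for m n
    proof -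
      have "(norm (X m - X n))\<^sup>2 < e\<^sup>2"
        using par[of "X m" "X n"] X[of m] X[of n] N[OF that(1)] N[OF that(2)] by simp
      then show ?thesis using \<open>0 < e\<close> by (simp add: dist_norm power2_less_imp_less)
    qed
    then show "\<exists>M. \<forall>m\<ge>M. \<forall>n\<ge>M. dist (X m) (X n) < e" by blast
  qed
  then obtain z where z: "X \<longlonglongrightarrow> z" using Cauchy_convergent_iff convergent_def by metis
  have "J z \<le> d"
  proof (rule LIMSEQ_le)
    show "(\<lambda>n. J (X n)) \<longlonglongrightarrow> J z"
      unfolding J_def by (intro tendsto_intros z F.tendsto)
    show "(\<lambda>n. d + inverse (real (Suc n))) \<longlonglongrightarrow> d"
      using tendsto_add[OF tendsto_const inv_lim, of d] by simp
    show "\<exists>N. \<forall>n\<ge>N. J (X n) \<le> d + inverse (real (Suc n))"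
      using X less_imp_le by blast
  qed
  then have min: "J z \<le> J y" for y using d_le[of y] by simp
  \<comment> \<open>Comparison of \<open>J z\<close> with the value at \<open>z + t x\<close>; the
    quadratic in \<open>t\<close> will force its linear coefficient to vanish.\<close>
  have ineq: "2 * t * (F x - x \<bullet> z) \<le> t\<^sup>2 * (norm x)\<^sup>2" for x t
    using min[of "z + t *\<^sub>R x"]
    unfolding J_def F.scaleR F.add power2_norm_eq_inner
    by (simp add: inner_add_left inner_add_right algebra_simps inner_commute power2_eq_square)
  have "F x = x \<bullet> z" for x
  proof (rule ccontr)
    assume neq: "F x \<noteq> x \<bullet> z"
    define a where "a = F x - x \<bullet> z"
    have "x \<noteq> 0" using neq F.zero by auto
    then have x: "(norm x)\<^sup>2 > 0" by simp
    \<comment> \<open>This \<open>t\<close> minimises \<open>t^2 ||x||^2 - 2 t a\<close>, with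
      negative minimum unless \<open>a = 0\<close>.\<close>
    have "2 * (a / (norm x)\<^sup>2) * a \<le> (a / (norm x)\<^sup>2)\<^sup>2 * (norm x)\<^sup>2"
      using ineq[of "a / (norm x)\<^sup>2" x] by (simp add: a_def)
    also have "\<dots> = a\<^sup>2 / (norm x)\<^sup>2" using x by (simp add: power2_eq_square field_simps)
    finally have "a\<^sup>2 / (norm x)\<^sup>2 \<le> 0" by (simp add: power2_eq_square)
    then show False using x neq by (simp add: a_def divide_le_0_iff)
  qed
  then show ?thesis by (rule that)
qed

text \<open>\<open>adjoint\<close> is defined by choice, so its defining identity holds only once
  some adjoint is known to exist; Riesz representation provides it.\<close>

lemma inner_adjoint:
  fixes A :: "'a::{real_inner, banach} \<Rightarrow> 'b::real_inner"
  assumes "bounded_linear A"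
  shows "A x \<bullet> y = x \<bullet> adjoint A y"
proof -
  have "\<exists>z. \<forall>x. A x \<bullet> y = x \<bullet> z" for y
  proof -
    have "bounded_linear (\<lambda>x. A x \<bullet> y)"
      using assms bounded_linear_compose[OF bounded_linear_inner_left] by blast
    then show ?thesis using riesz_representation by metis
  qed
  then have "\<exists>A'. \<forall>x y. A x \<bullet> y = x \<bullet> A' y" by metis
  from someI_ex[OF this] show ?thesis unfolding adjoint_def by blast
qed

text \<open>Linearity follows by testing against all vectors. For the bound,
  \<open>||S x||^2 = A (S x) \<bullet> A x\<close>, and one factor \<open>||S x||\<close>
  cancels.\<close>

lemma bounded_linear_adjoint_comp:
  fixes A :: "'a::{real_inner, banach} \<Rightarrow> 'b::real_inner"
  assumes A: "bounded_linear A"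
  shows "bounded_linear (\<lambda>x. adjoint A (A x))"
proof -
  interpret A: bounded_linear A by (rule A)
  note adj = inner_adjoint[OF A]
  obtain K where K: "\<And>x. norm (A x) \<le> norm x * K" "K > 0" using A.pos_bounded by auto
  show ?thesis
  proof (rule bounded_linear_intro)
    fix x y :: 'a and r :: real
    show "adjoint A (A (x + y)) = adjoint A (A x) + adjoint A (A y)"
      by (subst vector_eq_rdot[symmetric])
        (simp add: adj[symmetric] A.add inner_add_right inner_add_left inner_commute[of "adjoint A _"])
    show "adjoint A (A (r *\<^sub>R x)) = r *\<^sub>R adjoint A (A x)"
      by (subst vector_eq_rdot[symmetric])
        (simp add: adj[symmetric] A.scaleR inner_commute[of "adjoint A _"])
    let ?S = "adjoint A (A x)"
    have "(norm ?S)\<^sup>2 = A ?S \<bullet> A x" by (simp add: adj power2_norm_eq_inner)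
    also have "\<dots> \<le> norm (A ?S) * norm (A x)" by (rule norm_cauchy_schwarz)
    also have "\<dots> \<le> (norm ?S * K) * (norm x * K)" using K by (intro mult_mono) auto
    finally have "norm ?S * norm ?S \<le> norm ?S * (norm x * (K * K))"
      by (simp add: power2_eq_square algebra_simps)
    then show "norm ?S \<le> norm x * (K * K)"
      using K(2) by (cases "?S = 0") auto
  qed
qed

subsection \<open>Comparison of measures\<close>

text \<open>Induction over nonnegative measurable functions. Two measures on each side suffice for
  the polarisation and parallelogram type identities below; a zero coefficient discards a
  measure.\<close>

lemma nn_integral_comparison:
  assumes sets: "sets M1 = sets borel" "sets M2 = sets borel" "sets N1 = sets borel" "sets N2 = sets borel"
    and le: "\<And>B. B \<in> sets borel \<Longrightarrow>
      a1 * emeasure M1 B + a2 * emeasure M2 B \<le> b1 * emeasure N1 B + b2 * emeasure N2 B"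
    and u: "u \<in> borel_measurable (borel :: 'a::topological_space measure)"
  shows "a1 * nn_integral M1 u + a2 * nn_integral M2 u \<le> b1 * nn_integral N1 u + b2 * nn_integral N2 u"
proof -
  have meas: "(borel_measurable M1 :: ('a \<Rightarrow> ennreal) set) = borel_measurable borel"
     "(borel_measurable M2 :: ('a \<Rightarrow> ennreal) set) = borel_measurable borel"
     "(borel_measurable N1 :: ('a \<Rightarrow> ennreal) set) = borel_measurable borel"
     "(borel_measurable N2 :: ('a \<Rightarrow> ennreal) set) = borel_measurable borel"
    by (auto intro!: measurable_cong_sets simp: sets)
  have "u \<in> borel_measurable M1" using u meas by simp
  then show ?thesis
  proof (induction u rule: borel_measurable_induct)
    case (cong f g)
    have "space M1 = UNIV" using sets_eq_imp_space_eq[OF sets(1)] by simp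
    then have "f = g" using cong by auto
    with cong show ?case by simp
  next
    case (set B)
    with le[of B] show ?case by (simp add: sets)
  next
    case (mult u c)
    from mult_left_mono[OF mult.IH, of c] mult.hyps show ?case
      by (simp add: meas nn_integral_cmult distrib_left mult.left_commute)
  next
    case (add u v)
    from add_mono[OF add.IH] add.hyps show ?case
      by (simp add: meas nn_integral_add distrib_left add.commute add.left_commute)
  next
    case (seq U)
    have mono: "incseq (\<lambda>i. c * nn_integral M (U i))" for c and M :: "'a measure"
      using seq.hyps by (auto simp: incseq_def le_fun_def intro!: mult_left_mono nn_integral_mono)
    have sup: "nn_integral M (Sup (range U)) = (SUP i. nn_integral M (U i))" if "\<And>i. U i \<in> borel_measurable M" for M
      using nn_integral_monotone_convergence_SUP[OF seq.hyps(3) that] by (simp add: SUP_apply[abs_def])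
    have "a1 * nn_integral M1 (Sup (range U)) + a2 * nn_integral M2 (Sup (range U)) = 
        (SUP i. a1 * nn_integral M1 (U i) + a2 * nn_integral M2 (U i))"
      using seq.hyps(1) by (simp add: sup meas ennreal_SUP_add[OF mono mono] SUP_mult_left_ennreal)
    also have "\<dots> \<le> (SUP i. b1 * nn_integral N1 (U i) + b2 * nn_integral N2 (U i))"
      using seq.IH by (intro SUP_mono) auto
    also have "\<dots> = b1 * nn_integral N1 (Sup (range U)) + b2 * nn_integral N2 (Sup (range U))"
      using seq.hyps(1) by (simp add: sup meas ennreal_SUP_add[OF mono mono] SUP_mult_left_ennreal)
    finally show ?case .
  qed
qed

text \<open>Comparison in both directions gives equality for nonnegative integrands; positive and
  negative parts then give the signed case. This transfers identities between scalar measures to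
  first moments.\<close>

lemma integral_combination:
  fixes u :: "'a::topological_space \<Rightarrow> real"
  assumes sets: "sets M1 = sets borel" "sets M2 = sets borel" "sets N1 = sets borel" "sets N2 = sets borel"
    and eq: "\<And>B. B \<in> sets borel \<Longrightarrow>
      emeasure M1 B + emeasure M2 B = b1 * emeasure N1 B + emeasure N2 B"
    and int: "integrable M1 u" "integrable M2 u" "integrable N1 u" "integrable N2 u"
    and b1: "b1 = ennreal c" "c \<ge> 0"
  shows "integral\<^sup>L M1 u + integral\<^sup>L M2 u = c * integral\<^sup>L N1 u + integral\<^sup>L N2 u"
proof -
  have u: "u \<in> borel_measurable borel"
    using int(1) measurable_cong_sets[OF sets(1) refl] by auto
  have *: "nn_integral M1 v + nn_integral M2 v = b1 * nn_integral N1 v + nn_integral N2 v"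
    if "v \<in> borel_measurable borel" for v
    using nn_integral_comparison[OF sets, where ?a1.0=1 and ?a2.0=1 and ?b1.0=b1 and ?b2.0=1 and u=v]
      nn_integral_comparison[OF sets(3,4,1,2), where ?b1.0=1 and ?b2.0=1 and ?a1.0=b1 and ?a2.0=1 and u=v]
      eq that by (auto intro!: antisym)
  have **: "enn2real (nn_integral M1 v) + enn2real (nn_integral M2 v) =
      c * enn2real (nn_integral N1 v) + enn2real (nn_integral N2 v)"
    if v: "v \<in> borel_measurable borel" and fin: "nn_integral M1 v < \<infinity>" "nn_integral M2 v < \<infinity>"
       "nn_integral N1 v < \<infinity>" "nn_integral N2 v < \<infinity>" for v
  proof -
    have "enn2real (nn_integral M1 v + nn_integral M2 v) = enn2real (b1 * nn_integral N1 v + nn_integral N2 v)"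
      using *[OF v] by simp
    then show ?thesis using fin b1 by (simp add: enn2real_plus enn2real_mult ennreal_mult_less_top)
  qed
  have fin: "nn_integral M (\<lambda>x. ennreal (u x)) < \<infinity>" "nn_integral M (\<lambda>x. ennreal (- u x)) < \<infinity>"
    if "integrable M u" for M
    using that unfolding real_integrable_def by (auto simp: less_top)
  show ?thesis
    using **[of "\<lambda>x. ennreal (u x)"] **[of "\<lambda>x. ennreal (- u x)"] fin int u
    by (simp add: real_lebesgue_integral_def right_diff_distrib)
qed

subsection \<open>Concave functions on the half-line\<close>

text \<open>The tangent dominates a positive function, so it cannot vanish at a positive point. A
  negative slope would produce a zero to the right of \<open>u0\<close>, a negative intercept one to
  the left.\<close>

lemma concave_tangent:
  fixes \<Psi> :: "real \<Rightarrow> real"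
  assumes conc: "concave_on {0<..} \<Psi>" and pos: "\<And>t. t > 0 \<Longrightarrow> \<Psi> t > 0" and u0: "u0 > 0"
  obtains m where "m \<ge> 0" "m * u0 \<le> \<Psi> u0" "\<And>u. u > 0 \<Longrightarrow> \<Psi> u \<le> \<Psi> u0 + m * (u - u0)"
proof -
  obtain m where m: "\<And>u. u > 0 \<Longrightarrow> \<Psi> u \<le> \<Psi> u0 + m * (u - u0)"
  proof -
    \<comment> \<open>The right derivative of the convex function \<open>- \<Psi>\<close> at
      \<open>u0\<close>, hence a subgradient there.\<close>
    define k where "k = Inf ((\<lambda>t. ((- \<Psi> u0) - (- \<Psi> t)) / (u0 - t)) ` ({u0<..} \<inter> {0<..}))"
    have "- \<Psi> u \<ge> - \<Psi> u0 + k * (u - u0)" if "u > 0" for u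
      unfolding k_def
      using convex_le_Inf_differential[of "{0<..}" "\<lambda>x. - \<Psi> x" u0 u] conc that u0
      by (auto simp: concave_on_def interior_open)
    then show thesis by (intro that[of "- k"]) (simp add: algebra_simps)
  qed
  have "m \<ge> 0"
  proof (rule ccontr)
    assume "\<not> m \<ge> 0"
    then have neg: "- m > 0" by simp
    define u where "u = u0 + \<Psi> u0 / (- m)"
    have "u > 0" using pos[OF u0] u0 neg unfolding u_def by (intro add_pos_pos divide_pos_pos)
    moreover have "\<Psi> u0 + m * (u - u0) = 0" using neg by (simp add: u_def)
    ultimately show False using m[of u] pos[of u] by simp
  qed
  moreover have "m * u0 \<le> \<Psi> u0"
  proof (rule ccontr)
    assume less: "\<not> m * u0 \<le> \<Psi> u0"
    with \<open>m \<ge> 0\<close> pos[OF u0] have "m > 0" by (cases "m = 0") auto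
    define u where "u = u0 - \<Psi> u0 / m"
    have "u > 0" using less \<open>m > 0\<close> by (simp add: u_def field_simps)
    moreover have "\<Psi> u0 + m * (u - u0) = 0" using \<open>m > 0\<close> by (simp add: u_def)
    ultimately show False using m[of u] pos[of u] by simp
  qed
  ultimately show thesis using m that by blast
qed

text \<open>The tangent at \<open>u\<close> has nonnegative intercept, so to the right of
  \<open>u\<close> it stays below the ray from the origin through
  \<open>(u, \<Psi> u)\<close>.\<close>

lemma concave_quotient_antimono:
  fixes \<Psi> :: "real \<Rightarrow> real"
  assumes conc: "concave_on {0<..} \<Psi>" and pos: "\<And>t. t > 0 \<Longrightarrow> \<Psi> t > 0" and "0 < u" "u \<le> v"
  shows "\<Psi> v / v \<le> \<Psi> u / u"
proof -
  obtain m where m: "m * u \<le> \<Psi> u" "\<And>w. w > 0 \<Longrightarrow> \<Psi> w \<le> \<Psi> u + m * (w - u)"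
    using concave_tangent[OF conc pos \<open>0 < u\<close>] by metis
  have "u * \<Psi> v \<le> u * (\<Psi> u + m * (v - u))" using m(2)[of v] assms by simp
  also have "\<dots> = u * \<Psi> u + (m * u) * (v - u)" by (simp add: algebra_simps)
  also have "\<dots> \<le> u * \<Psi> u + \<Psi> u * (v - u)" using m(1) assms by (intro add_left_mono mult_right_mono) auto
  also have "\<dots> = \<Psi> u * v" by (simp add: algebra_simps)
  finally show ?thesis using assms by (simp add: field_simps)
qed

lemma rate_function_concave_bound:
  fixes \<Psi> \<xi> :: "real \<Rightarrow> real"
  assumes idx: "index_function \<Psi>" and conc: "concave_on {0<..} \<Psi>"
    and lim: "((\<lambda>t. \<Psi> t / t) \<longlongrightarrow> 0) at_top"
    and rate: "rate_function_on {0<..d} \<xi>" and "d > 0" "C > 0" "r > 0"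
  shows "rate_function_on {0<..d} (\<lambda>\<delta>. C * \<xi> \<delta> * sqrt (\<Psi> ((r / (C * \<xi> \<delta>))\<^sup>2)))"
proof -
  have cont: "continuous_on {0<..} \<Psi>" and pos: "\<And>t. t > 0 \<Longrightarrow> \<Psi> t > 0"
    using idx by (auto simp: index_function_def)
  have \<xi>: "continuous_on {0<..d} \<xi>" "\<And>t. t \<in> {0<..d} \<Longrightarrow> \<xi> t > 0" "mono_on {0<..d} \<xi>" "(\<xi> \<longlongrightarrow> 0) (at_right 0)"
    using rate by (auto simp: rate_function_on_def)
  define U where "U \<delta> = (r / (C * \<xi> \<delta>))\<^sup>2" for \<delta>
  have U_pos: "U \<delta> > 0" if "\<delta> \<in> {0<..d}" for \<delta>
    using \<xi>(2)[OF that] assms by (simp add: U_def)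
  \<comment> \<open>Continuity and positivity are read off the left-hand form, monotonicity and the
    limit off the right-hand one.\<close>
  have eq: "C * \<xi> \<delta> * sqrt (\<Psi> (U \<delta>)) = r * sqrt (\<Psi> (U \<delta>) / U \<delta>)" if "\<delta> \<in> {0<..d}" for \<delta>
    using \<xi>(2)[OF that] assms by (simp add: U_def real_sqrt_divide)
  have "continuous_on {0<..d} (\<lambda>\<delta>. C * \<xi> \<delta> * sqrt (\<Psi> (U \<delta>)))"
  proof (intro continuous_intros \<xi>(1) continuous_on_compose2[OF cont])
    show "continuous_on {0<..d} U" unfolding U_def
      using \<open>C > 0\<close> by (intro continuous_intros \<xi>(1)) (auto dest!: \<xi>(2))
  qed (use U_pos in auto)
  moreover have "0 < C * \<xi> t * sqrt (\<Psi> (U t))" if "t \<in> {0<..d}" for t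
    using \<xi>(2)[OF that] pos[OF U_pos[OF that]] assms by simp
  moreover have "mono_on {0<..d} (\<lambda>\<delta>. C * \<xi> \<delta> * sqrt (\<Psi> (U \<delta>)))"
  proof (rule mono_onI)
    fix s t assume st: "s \<in> {0<..d}" "t \<in> {0<..d}" "s \<le> t"
    have "\<xi> s \<le> \<xi> t" using st by (intro mono_onD[OF \<xi>(3)])
    then have "U t \<le> U s" using \<xi>(2)[OF st(1)] \<xi>(2)[OF st(2)] assms unfolding U_def
      by (intro power_mono divide_left_mono mult_left_mono mult_pos_pos) auto
    then have "\<Psi> (U s) / U s \<le> \<Psi> (U t) / U t"
      by (intro concave_quotient_antimono conc pos U_pos st)
    then show "C * \<xi> s * sqrt (\<Psi> (U s)) \<le> C * \<xi> t * sqrt (\<Psi> (U t))"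
      unfolding eq[OF st(1)] eq[OF st(2)] using assms by simp
  qed
  moreover have "((\<lambda>\<delta>. C * \<xi> \<delta> * sqrt (\<Psi> (U \<delta>))) \<longlongrightarrow> 0) (at_right 0)"
  proof -
    have ev: "\<forall>\<^sub>F \<delta> in at_right 0. \<delta> \<in> {0<..d}"
      using \<open>d > 0\<close> by (auto simp: eventually_at_right_field intro: exI[of _ d])
    \<comment> \<open>Positivity sharpens convergence to 0 into convergence from the right, so the
      reciprocal tends to plus infinity.\<close>
    have "filterlim (\<lambda>\<delta>. C * \<xi> \<delta>) (at_right 0) (at_right 0)"
      unfolding filterlim_at using tendsto_mult[OF tendsto_const \<xi>(4), of C] ev
      by (auto elim!: eventually_mono simp: \<open>C > 0\<close> \<xi>(2) less_imp_neq[symmetric])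
    then have "filterlim (\<lambda>\<delta>. inverse (C * \<xi> \<delta>)) at_top (at_right 0)"
      by (rule filterlim_compose[OF filterlim_inverse_at_top_right])
    then have "filterlim (\<lambda>\<delta>. r * inverse (C * \<xi> \<delta>)) at_top (at_right 0)"
      using \<open>r > 0\<close> by (intro filterlim_tendsto_pos_mult_at_top[OF tendsto_const])
    then have "filterlim U at_top (at_right 0)"
      unfolding U_def by (intro filterlim_pow_at_top) (auto simp: divide_inverse)
    from filterlim_compose[OF lim this]
    have lim_r: "((\<lambda>\<delta>. r * sqrt (\<Psi> (U \<delta>) / U \<delta>)) \<longlongrightarrow> r * sqrt 0) (at_right 0)"
      by (intro tendsto_intros)
    have "\<forall>\<^sub>F \<delta> in at_right 0. r * sqrt (\<Psi> (U \<delta>) / U \<delta>) = C * \<xi> \<delta> * sqrt (\<Psi> (U \<delta>))"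
      using ev by eventually_elim (simp add: eq)
    from Lim_transform_eventually[OF lim_r this] show ?thesis by simp
  qed
  ultimately show ?thesis by (simp add: rate_function_on_def U_def)
qed

subsection \<open>Projection-valued measures\<close>

text \<open>The off-diagonal spectral measure of the pair. It is the intended measure only if all
  values are nonnegative, so its evaluation carries that hypothesis; the pairs used later are
  \<open>(S x, x)\<close>, besides the diagonal ones.\<close>

definition cross_measure :: "(real set \<Rightarrow> 'a::real_inner \<Rightarrow> 'a) \<Rightarrow> 'a \<Rightarrow> 'a \<Rightarrow> real measure" where
  "cross_measure E x y = measure_of UNIV (sets borel) (\<lambda>B. ennreal (E B x \<bullet> y))"

lemma scalar_measure_eq_cross: "scalar_measure E x = cross_measure E x x"
  by (simp add: scalar_measure_def cross_measure_def)

lemma sets_cross_measure [simp, measurable_cong]: "sets (cross_measure E x y) = sets borel"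
  using sets.sigma_sets_eq[of "borel :: real measure"] by (simp add: cross_measure_def)

lemma space_cross_measure [simp]: "space (cross_measure E x y) = UNIV"
  by (simp add: cross_measure_def)

lemma sets_scalar_measure [simp, measurable_cong]: "sets (scalar_measure E x) = sets borel"
  by (simp add: scalar_measure_eq_cross)

lemma space_scalar_measure [simp]: "space (scalar_measure E x) = UNIV"
  by (simp add: scalar_measure_eq_cross)

locale pvm =
  fixes E :: "real set \<Rightarrow> 'a::real_inner \<Rightarrow> 'a"
  assumes pvm: "projection_valued_measure E"
begin

lemma bounded_linear_E: "B \<in> sets borel \<Longrightarrow> bounded_linear (E B)"
  and self_adjoint: "B \<in> sets borel \<Longrightarrow> E B x \<bullet> y = x \<bullet> E B y"
  and E_UNIV [simp]: "E UNIV x = x"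
  and E_Int: "B \<in> sets borel \<Longrightarrow> C \<in> sets borel \<Longrightarrow> E (B \<inter> C) x = E B (E C x)"
  and E_sums: "range D \<subseteq> sets borel \<Longrightarrow> disjoint_family D \<Longrightarrow> (\<lambda>n. E (D n) x) sums E (\<Union>n::nat. D n) x"
  using pvm unfolding projection_valued_measure_def by blast+

lemmas E_add = linear_add[OF bounded_linear.linear[OF bounded_linear_E]]
  and E_diff = linear_diff[OF bounded_linear.linear[OF bounded_linear_E]]
  and E_scaleR = linear_scale[OF bounded_linear.linear[OF bounded_linear_E]]

lemma E_idem: "B \<in> sets borel \<Longrightarrow> E B (E B x) = E B x"
  using E_Int[of B B x] by simp

text \<open>Countable additivity for the constant sequence of empty sets makes a constant series
  converge, so its term is zero.\<close>

lemma E_empty [simp]: "E {} x = 0"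
  using E_sums[of "\<lambda>_. {}" x] summable_LIMSEQ_zero[of "\<lambda>_::nat. E {} x"]
  by (auto simp: disjoint_family_on_def sums_iff LIMSEQ_const_iff)

lemma inner_E: "B \<in> sets borel \<Longrightarrow> E B x \<bullet> y = E B x \<bullet> E B y"
  by (metis E_idem self_adjoint)

lemma inner_E_self: "B \<in> sets borel \<Longrightarrow> E B x \<bullet> x = (norm (E B x))\<^sup>2"
  using inner_E[of B x x] by (simp add: power2_norm_eq_inner)

lemma inner_E_nonneg: "B \<in> sets borel \<Longrightarrow> 0 \<le> E B x \<bullet> x"
  by (simp add: inner_E_self)

lemma norm_E_le: "B \<in> sets borel \<Longrightarrow> norm (E B x) \<le> norm x"
  using norm_cauchy_schwarz[of "E B x" x] inner_E_self[of B x]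
  by (cases "E B x = 0") (auto simp: power2_eq_square)

lemma E_Un:
  assumes "B \<in> sets borel" "C \<in> sets borel" "B \<inter> C = {}"
  shows "E (B \<union> C) x = E B x + E C x"
proof -
  define D where "D = (\<lambda>n::nat. if n = 0 then B else if n = 1 then C else {})"
  have "(\<lambda>n. E (D n) x) sums E (\<Union>n. D n) x"
    using assms by (intro E_sums) (auto simp: D_def disjoint_family_on_def split: if_splits)
  moreover have "(\<Union>n. D n) = B \<union> C" by (auto simp: D_def split: if_splits)
  moreover have "(\<lambda>n. E (D n) x) sums (\<Sum>n<2. E (D n) x)"
    by (rule sums_finite) (auto simp: D_def)
  moreover have "(\<Sum>n<2. E (D n) x) = E B x + E C x" by (simp add: D_def numeral_2_eq_2)
  ultimately show ?thesis using sums_unique2 by metis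
qed

lemma E_Compl: "B \<in> sets borel \<Longrightarrow> E (- B) x = x - E B x"
  using E_Un[of B "- B" x] by (simp add: algebra_simps Compl_partition)

lemma emeasure_cross:
  assumes nonneg: "\<And>B. B \<in> sets borel \<Longrightarrow> 0 \<le> E B x \<bullet> y" and B: "B \<in> sets borel"
  shows "emeasure (cross_measure E x y) B = ennreal (E B x \<bullet> y)"
proof -
  have "positive (sets (cross_measure E x y)) (\<lambda>B. ennreal (E B x \<bullet> y))"
    by (simp add: positive_def)
  moreover have "countably_additive (sets (cross_measure E x y)) (\<lambda>B. ennreal (E B x \<bullet> y))"
  proof (rule countably_additiveI)
    fix D :: "nat \<Rightarrow> real set"
    assume D: "range D \<subseteq> sets (cross_measure E x y)" "disjoint_family D"
    have "(\<lambda>n. E (D n) x \<bullet> y) sums (E (\<Union>n. D n) x \<bullet> y)"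
      using E_sums[of D x] D by (intro bounded_linear.sums[OF bounded_linear_inner_left]) simp
    then show "(\<Sum>i. ennreal (E (D i) x \<bullet> y)) = ennreal (E (\<Union> (range D)) x \<bullet> y)"
      using D nonneg by (intro suminf_ennreal_eq) auto
  qed
  ultimately show ?thesis
    using B emeasure_measure_of[OF cross_measure_def, of E x y B] by auto
qed

lemma emeasure_scalar: "B \<in> sets borel \<Longrightarrow> emeasure (scalar_measure E x) B = ennreal (E B x \<bullet> x)"
  unfolding scalar_measure_eq_cross by (intro emeasure_cross inner_E_nonneg)

lemma emeasure_scalar_norm: "B \<in> sets borel \<Longrightarrow> emeasure (scalar_measure E x) B = ennreal ((norm (E B x))\<^sup>2)"
  by (simp add: emeasure_scalar inner_E_self)

lemma finite_measure_cross:
  "(\<And>B. B \<in> sets borel \<Longrightarrow> 0 \<le> E B x \<bullet> y) \<Longrightarrow> finite_measure (cross_measure E x y)"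
  by (intro finite_measureI) (simp add: emeasure_cross)

lemma finite_measure_scalar: "finite_measure (scalar_measure E x)"
  unfolding scalar_measure_eq_cross by (intro finite_measure_cross inner_E_nonneg)

lemma AE_cross:
  assumes "\<And>B. B \<in> sets borel \<Longrightarrow> 0 \<le> E B x \<bullet> y" and B: "B \<in> sets borel" "E B x = x"
  shows "AE t in cross_measure E x y. t \<in> B"
proof (rule AE_I[of _ _ "- B"])
  show "emeasure (cross_measure E x y) (- B) = 0"
    using assms by (simp add: emeasure_cross E_Compl)
qed (use B in auto)

lemma AE_scalar: "B \<in> sets borel \<Longrightarrow> E B x = x \<Longrightarrow> AE t in scalar_measure E x. t \<in> B"
  unfolding scalar_measure_eq_cross by (intro AE_cross inner_E_nonneg)

section \<open>Domain and bilinear form of the spectral integral of the identity\<close>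

abbreviation dom :: "'a set" where "dom \<equiv> spectral_domain E (\<lambda>t. t)"

definition form :: "'a \<Rightarrow> 'a \<Rightarrow> real" where
  "form x z = ((\<integral>t. t \<partial>scalar_measure E (x + z)) - (\<integral>t. t \<partial>scalar_measure E (x - z))) / 4"

lemma mem_dom_iff: "x \<in> dom \<longleftrightarrow> (\<integral>\<^sup>+t. ennreal (t\<^sup>2) \<partial>scalar_measure E x) < \<infinity>"
  by (auto simp: spectral_domain_def integrable_iff_bounded)

lemma dom_integrable: "x \<in> dom \<Longrightarrow> integrable (scalar_measure E x) (\<lambda>t. t)"
  using finite_measure.square_integrable_imp_integrable[OF finite_measure_scalar, of "\<lambda>t. t" x]
  by (simp add: spectral_domain_def)

text \<open>Membership in \<open>dom\<close> is finiteness of the second moment of the scalar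
  measure, so setwise domination transfers it. Closure under differences and under
  \<open>E B\<close> follows.\<close>

lemma dom_comparison:
  assumes x: "x \<in> dom" and y: "y \<in> dom"
    and le: "\<And>B. B \<in> sets borel \<Longrightarrow> E B z \<bullet> z \<le> a * (E B x \<bullet> x) + b * (E B y \<bullet> y)" "a \<ge> 0" "b \<ge> 0"
  shows "z \<in> dom"
proof -
  have "1 * nn_integral (scalar_measure E z) (\<lambda>t. ennreal (t\<^sup>2)) + 0 * nn_integral (scalar_measure E z) (\<lambda>t. ennreal (t\<^sup>2)) \<le>
    ennreal a * nn_integral (scalar_measure E x) (\<lambda>t. ennreal (t\<^sup>2)) + ennreal b * nn_integral (scalar_measure E y) (\<lambda>t. ennreal (t\<^sup>2))"
    using le by (intro nn_integral_comparison)
      (auto simp: emeasure_scalar inner_E_nonneg simp flip: ennreal_mult ennreal_plus intro!: ennreal_leI)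
  also have "\<dots> < \<infinity>" using x y by (simp add: mem_dom_iff ennreal_mult_less_top)
  finally show ?thesis by (simp add: mem_dom_iff)
qed

text \<open>Expanding \<open>\<parallel>a\<^sup>1\<^sup>/\<^sup>2 E B x + a\<^sup>-\<^sup>1\<^sup>/\<^sup>2 E B y\<parallel>\<^sup>2 \<ge> 0\<close>.\<close>

lemma inner_E_diff_le:
  assumes "a > 0" and B: "B \<in> sets borel"
  shows "E B (x - y) \<bullet> (x - y) \<le> (1 + a) * (E B x \<bullet> x) + (1 + 1 / a) * (E B y \<bullet> y)"
proof -
  have "0 \<le> E B (a *\<^sub>R x + y) \<bullet> (a *\<^sub>R x + y)" by (rule inner_E_nonneg[OF B])
  also have "\<dots> = a\<^sup>2 * (E B x \<bullet> x) + 2 * a * (E B x \<bullet> y) + E B y \<bullet> y"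
    using B self_adjoint[OF B, of y x]
    by (simp add: E_add E_scaleR inner_add_left inner_add_right power2_eq_square inner_commute algebra_simps)
  finally have "0 \<le> (a\<^sup>2 * (E B x \<bullet> x) + 2 * a * (E B x \<bullet> y) + E B y \<bullet> y) / a"
    using \<open>a > 0\<close> by simp
  also have "\<dots> = a * (E B x \<bullet> x) + 2 * (E B x \<bullet> y) + (1 / a) * (E B y \<bullet> y)"
    using \<open>a > 0\<close> by (simp add: field_simps power2_eq_square)
  finally show ?thesis using B self_adjoint[OF B, of y x]
    by (simp add: E_diff inner_diff_left inner_diff_right algebra_simps inner_commute)
qed

lemma dom_diff: "x \<in> dom \<Longrightarrow> y \<in> dom \<Longrightarrow> x - y \<in> dom"
  by (rule dom_comparison[where a=2 and b=2 and x=x and y=y]) (use inner_E_diff_le[of 1] in auto)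

lemma dom_uminus: "x \<in> dom \<Longrightarrow> - x \<in> dom"
  by (rule dom_comparison[where a=1 and b=0 and y=x]) (auto simp: linear_neg[OF bounded_linear.linear[OF bounded_linear_E]])

lemma dom_add: "x \<in> dom \<Longrightarrow> y \<in> dom \<Longrightarrow> x + y \<in> dom"
  using dom_diff[OF _ dom_uminus, of x y] by simp

lemma dom_E: "x \<in> dom \<Longrightarrow> B \<in> sets borel \<Longrightarrow> E B x \<in> dom"
proof (rule dom_comparison[where a=1 and b=0 and x=x and y=x])
  fix C :: "real set" assume B: "B \<in> sets borel" and C: "C \<in> sets borel"
  \<comment> \<open>\<open>E C\<close> and \<open>E B\<close> commute, and \<open>E B\<close> is a
    contraction.\<close>
  have "(norm (E C (E B x)))\<^sup>2 \<le> (norm (E C x))\<^sup>2"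
    using norm_E_le[OF B, of "E C x"] B C by (metis E_Int Int_commute norm_ge_zero power_mono)
  then show "E C (E B x) \<bullet> E B x \<le> 1 * (E C x \<bullet> x) + 0 * (E C x \<bullet> x)"
    by (simp add: inner_E_self C)
qed auto

lemma bounded_mem_dom:
  assumes "E B x = x" "B \<in> sets borel" "bounded B"
  shows "x \<in> dom"
proof -
  interpret finite_measure "scalar_measure E x" by (rule finite_measure_scalar)
  obtain K where K: "\<And>t. t \<in> B \<Longrightarrow> \<bar>t\<bar> \<le> K" using \<open>bounded B\<close> by (auto simp: bounded_iff)
  have "AE t in scalar_measure E x. norm (t\<^sup>2) \<le> K\<^sup>2"
    using AE_scalar[OF assms(2,1)] by eventually_elim (use K in \<open>auto simp: abs_le_square_iff[symmetric] intro: order_trans[OF _ abs_ge_self]\<close>)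
  then show ?thesis unfolding spectral_domain_def by (auto intro: integrable_const_bound[where B="K\<^sup>2"])
qed

text \<open>Polarisation on the level of measures, rearranged as a sum of nonnegative terms so that
  no signed measure occurs.\<close>

lemma form_eq_cross:
  assumes x: "x \<in> dom" and z: "z \<in> dom" and nonneg: "\<And>B. B \<in> sets borel \<Longrightarrow> 0 \<le> E B x \<bullet> z"
  shows "integrable (cross_measure E x z) (\<lambda>t. t)"
    and "form x z = (\<integral>t. t \<partial>cross_measure E x z)"
proof -
  have polar: "E B (x + z) \<bullet> (x + z) = 4 * (E B x \<bullet> z) + E B (x - z) \<bullet> (x - z)" if "B \<in> sets borel" for B
    using that self_adjoint[OF that, of z x]
    by (simp add: E_add E_diff inner_diff_left inner_diff_right inner_add_left inner_add_right inner_commute)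
  have sum: "emeasure (scalar_measure E (x + z)) B = ennreal 4 * emeasure (cross_measure E x z) B
      + emeasure (scalar_measure E (x - z)) B" if "B \<in> sets borel" for B
    using that nonneg[OF that]
    by (simp add: emeasure_scalar emeasure_cross nonneg polar inner_E_nonneg ennreal_plus ennreal_mult del: ennreal_numeral)
  have dom: "x + z \<in> dom" "x - z \<in> dom" using x z by (auto intro: dom_add dom_diff)
  have "4 * nn_integral (cross_measure E x z) (\<lambda>t. ennreal \<bar>t\<bar>) + 0 * nn_integral (cross_measure E x z) (\<lambda>t. ennreal \<bar>t\<bar>)
     \<le> 1 * nn_integral (scalar_measure E (x + z)) (\<lambda>t. ennreal \<bar>t\<bar>) + 0 * nn_integral (cross_measure E x z) (\<lambda>t. ennreal \<bar>t\<bar>)"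
    by (rule nn_integral_comparison) (auto simp: sum)
  also have "\<dots> < \<infinity>" using dom_integrable[OF dom(1)] by (simp add: integrable_iff_bounded)
  finally show int: "integrable (cross_measure E x z) (\<lambda>t. t)"
    by (auto simp: integrable_iff_bounded ennreal_mult_less_top)
  \<comment> \<open>The null measure of the zero vector fills the fourth slot of
    \<open>integral_combination\<close>.\<close>
  have zero: "emeasure (scalar_measure E 0) B = 0" if "B \<in> sets borel" for B
    using that by (simp add: emeasure_scalar)
  have "0 \<in> dom" using dom_diff[OF x x] by simp
  have "integral\<^sup>L (scalar_measure E (x + z)) (\<lambda>t. t) + integral\<^sup>L (scalar_measure E 0) (\<lambda>t. t)
    = 4 * integral\<^sup>L (cross_measure E x z) (\<lambda>t. t) + integral\<^sup>L (scalar_measure E (x - z)) (\<lambda>t. t)"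
    by (rule integral_combination[where ?b1.0="ennreal 4"])
      (auto simp: sum zero simp del: ennreal_numeral intro: int dom_integrable dom \<open>0 \<in> dom\<close>)
  moreover have "integral\<^sup>L (scalar_measure E 0) (\<lambda>t. t) = 0"
    using zero[of UNIV] by (intro integral_eq_zero_AE AE_I[where N=UNIV]) auto
  ultimately show "form x z = (\<integral>t. t \<partial>cross_measure E x z)" by (simp add: form_def)
qed

text \<open>The two sides are quarters of differences of first moments, for \<open>?a\<close>,
  \<open>?c\<close> and for \<open>?d\<close>, \<open>?b\<close>. Moving the negative terms across
  leaves an identity of positive measures, which holds because \<open>E C\<close> commutes with
  \<open>E B\<close>.\<close>

lemma form_E_left:
  assumes x: "x \<in> dom" and z: "z \<in> dom" and B: "B \<in> sets borel"
  shows "form (E B x) z = form x (E B z)"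
proof -
  let ?a = "E B x + z" and ?b = "x - E B z" and ?c = "E B x - z" and ?d = "x + E B z"
  have dom: "?a \<in> dom" "?b \<in> dom" "?c \<in> dom" "?d \<in> dom"
    using assms by (auto intro: dom_add dom_diff dom_E)
  have "E C ?a \<bullet> ?a + E C ?b \<bullet> ?b = E C ?c \<bullet> ?c + E C ?d \<bullet> ?d" if C: "C \<in> sets borel" for C
  proof -
    have "E C (E B x) \<bullet> z = E C x \<bullet> E B z" 
      by (metis B C E_Int Int_commute self_adjoint)
    moreover have "E C z \<bullet> E B x = E C (E B x) \<bullet> z" "E C (E B z) \<bullet> x = E C x \<bullet> E B z"
      by (metis C self_adjoint inner_commute)+
    ultimately show ?thesis using C
      by (simp add: E_add E_diff inner_diff_left inner_diff_right inner_add_left inner_add_right)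
  qed
  then have "emeasure (scalar_measure E ?a) C + emeasure (scalar_measure E ?b) C =
      ennreal 1 * emeasure (scalar_measure E ?c) C + emeasure (scalar_measure E ?d) C"
    if "C \<in> sets borel" for C
    using that by (simp add: emeasure_scalar inner_E_nonneg flip: ennreal_plus)
  then have "integral\<^sup>L (scalar_measure E ?a) (\<lambda>t. t) + integral\<^sup>L (scalar_measure E ?b) (\<lambda>t. t)
     = 1 * integral\<^sup>L (scalar_measure E ?c) (\<lambda>t. t) + integral\<^sup>L (scalar_measure E ?d) (\<lambda>t. t)"
    by (intro integral_combination[where ?b1.0="ennreal 1"]) (auto intro!: dom_integrable dom)
  then show ?thesis by (simp add: form_def)
qed

lemma mem_spectral_integral_iff:
  "(x, y) \<in> spectral_integral E (\<lambda>t. t) \<longleftrightarrow> x \<in> dom \<and> (\<forall>z\<in>dom. y \<bullet> z = form x z)"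
  by (simp add: spectral_integral_def form_def)

end

subsection \<open>The spectral measure of \<open>(A\<^sup>* A)\<^sup>-\<^sup>1\<close>\<close>

locale spectral_measure_of_generator = pvm E
  for E :: "real set \<Rightarrow> 'a::{real_inner, banach} \<Rightarrow> 'a" +
  fixes A :: "'a \<Rightarrow> 'b::real_inner"
  assumes A: "bounded_linear A" and inj_A: "inj A"
    and generator: "scale_generator A = spectral_integral E (\<lambda>t. t)"
begin

definition S :: "'a \<Rightarrow> 'a" where "S x = adjoint A (A x)"

lemma bounded_linear_S: "bounded_linear S"
  using bounded_linear_adjoint_comp[OF A] by (simp add: S_def[abs_def])

lemmas S_zero = linear_0[OF bounded_linear.linear[OF bounded_linear_S]]

lemma inner_S: "x \<bullet> S y = A x \<bullet> A y"
  by (simp add: S_def inner_adjoint[OF A])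

lemma inner_S_self: "x \<bullet> S x = (norm (A x))\<^sup>2"
  by (simp add: inner_S power2_norm_eq_inner)

lemma S_eq_zero: "S x = 0 \<Longrightarrow> x = 0"
  using inner_S_self[of x] injD[OF inj_A, of x 0] linear_0[OF bounded_linear.linear[OF A]] by simp

text \<open>The operator inequality \<open>S^2 \<le> ||S|| S\<close>, from Cauchy-Schwarz for the
  inner product \<open>A x \<bullet> A y\<close> applied to \<open>S x\<close> and
  \<open>x\<close>.\<close>

lemma norm_S_square_le: "(norm (S x))\<^sup>2 \<le> onorm S * (norm (A x))\<^sup>2"
proof -
  have "S x \<bullet> S (S x) \<le> norm (S x) * norm (S (S x))" by (rule norm_cauchy_schwarz)
  also have "\<dots> \<le> norm (S x) * (onorm S * norm (S x))"
    by (intro mult_left_mono onorm[OF bounded_linear_S]) simp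
  finally have S2: "S x \<bullet> S (S x) \<le> norm (S x) * (onorm S * norm (S x))" .
  have "((norm (S x))\<^sup>2)\<^sup>2 = (A (S x) \<bullet> A x)\<^sup>2"
    using inner_S[of "S x" x] by (simp add: power2_norm_eq_inner)
  also have "\<dots> \<le> (A (S x) \<bullet> A (S x)) * (A x \<bullet> A x)" by (rule Cauchy_Schwarz_ineq)
  also have "\<dots> = (S x \<bullet> S (S x)) * (norm (A x))\<^sup>2" by (simp add: inner_S power2_norm_eq_inner)
  also have "\<dots> \<le> (norm (S x) * (onorm S * norm (S x))) * (norm (A x))\<^sup>2"
    by (intro mult_right_mono S2) simp
  finally have *: "(norm (S x))\<^sup>2 * (norm (S x))\<^sup>2 \<le> (norm (S x))\<^sup>2 * (onorm S * (norm (A x))\<^sup>2)"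
    by (simp only: power2_eq_square mult_ac)
  show ?thesis
  proof (cases "S x = 0")
    case True
    then show ?thesis using onorm_pos_le[OF bounded_linear_S] by simp
  next
    case False
    then show ?thesis by (intro mult_left_le_imp_le[OF *]) simp
  qed
qed

section \<open>From the graph identity to commutation and moment formulas\<close>

lemma S_in_dom: "S y \<in> dom"
  and inner_eq_form: "z \<in> dom \<Longrightarrow> y \<bullet> z = form (S y) z"
proof -
  have "(S y, y) \<in> scale_generator A" by (auto simp: scale_generator_def S_def)
  then have "(S y, y) \<in> spectral_integral E (\<lambda>t. t)" by (simp add: generator)
  then show "S y \<in> dom" and "z \<in> dom \<Longrightarrow> y \<bullet> z = form (S y) z"
    by (auto simp: mem_spectral_integral_iff)
qed

text \<open>By \<open>form_E_left\<close> the pair \<open>(E B (S y), E B y)\<close> satisfies the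
  form condition, so it lies in the graph of \<open>T\<close>, where the first component is
  \<open>S\<close> applied to the second.\<close>

lemma E_S_commute: "B \<in> sets borel \<Longrightarrow> E B (S y) = S (E B y)"
proof -
  assume B: "B \<in> sets borel"
  have "E B y \<bullet> z = form (E B (S y)) z" if "z \<in> dom" for z
    using inner_eq_form[OF dom_E[OF that B], of y]
    by (simp add: self_adjoint[OF B] form_E_left[OF S_in_dom that B])
  then have "(E B (S y), E B y) \<in> spectral_integral E (\<lambda>t. t)"
    using B by (auto simp: mem_spectral_integral_iff S_in_dom dom_E)
  then show ?thesis by (auto simp: generator[symmetric] scale_generator_def S_def)
qed

text \<open>Makes \<open>cross_measure E (S x) x\<close> a genuine measure, of total mass
  \<open>||A x||^2\<close>.\<close>

lemma inner_E_S: "B \<in> sets borel \<Longrightarrow> E B (S x) \<bullet> x = (norm (A (E B x)))\<^sup>2"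
  by (metis E_S_commute inner_E inner_S_self inner_commute)

lemma inner_E_S_nonneg: "B \<in> sets borel \<Longrightarrow> 0 \<le> E B (S x) \<bullet> x"
  by (simp add: inner_E_S)

text \<open>The first moment of \<open>S y\<close> is the form of \<open>T\<close> at
  \<open>S y\<close>, and \<open>T (S y) = y\<close>.\<close>

lemma integral_scalar_S: "(\<integral>t. t \<partial>scalar_measure E (S y)) = (norm (A y))\<^sup>2"
  using inner_eq_form[OF S_in_dom[of y], of y]
    form_eq_cross(2)[OF S_in_dom[of y] S_in_dom[of y] inner_E_nonneg]
  by (simp add: scalar_measure_eq_cross inner_S_self)

lemma integral_cross_S: "w \<in> dom \<Longrightarrow> (\<integral>t. t \<partial>cross_measure E (S w) w) = (norm w)\<^sup>2"
  and integrable_cross_S: "w \<in> dom \<Longrightarrow> integrable (cross_measure E (S w) w) (\<lambda>t. t)"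
  using inner_eq_form[of w w] form_eq_cross[OF S_in_dom[of w] _ inner_E_S_nonneg]
  by (auto simp: power2_norm_eq_inner)

section \<open>Location of the spectrum and norm bounds on spectral subspaces\<close>

text \<open>On the range of \<open>E {..<c}\<close> the integrand \<open>c - t\<close> is positive
  almost everywhere, while \<open>norm_S_square_le\<close> makes its integral nonpositive. So the
  measure of \<open>S w\<close> is null, and injectivity gives \<open>w = 0\<close>.\<close>

lemma E_below_spectrum:
  assumes "c \<le> inverse (onorm S)"
  shows "E {..<c} y = 0"
proof -
  define w where "w = E {..<c} y"
  let ?M = "scalar_measure E (S w)"
  interpret M: finite_measure ?M by (rule finite_measure_scalar)
  have "E {..<c} (S w) = S w" by (simp add: w_def E_S_commute E_idem)
  then have AE: "AE t in ?M. t < c" using AE_scalar[of "{..<c}" "S w"] by simp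
  have int: "integrable ?M (\<lambda>t. c - t)" using dom_integrable[OF S_in_dom] by simp
  have M: "measure ?M UNIV = (norm (S w))\<^sup>2"
    using emeasure_scalar_norm[of UNIV "S w"] by (simp add: measure_def)
  have "(\<integral>t. c - t \<partial>?M) = c * (norm (S w))\<^sup>2 - (norm (A w))\<^sup>2"
    using dom_integrable[OF S_in_dom[of w]] integral_scalar_S[of w] M by simp
  also have "c * (norm (S w))\<^sup>2 \<le> inverse (onorm S) * (onorm S * (norm (A w))\<^sup>2)"
    using assms norm_S_square_le[of w] onorm_pos_le[OF bounded_linear_S]
    by (intro order_trans[OF mult_right_mono mult_left_mono]) auto
  \<comment> \<open>The case \<open>onorm S = 0\<close> is separate because
    \<open>inverse 0 = 0\<close>.\<close>
  also have "\<dots> \<le> (norm (A w))\<^sup>2" by (cases "onorm S = 0") (simp_all flip: mult.assoc)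
  finally have "(\<integral>t. c - t \<partial>?M) \<le> 0" by simp
  moreover have nonneg: "AE t in ?M. 0 \<le> c - t" using AE by eventually_elim simp
  ultimately have "(\<integral>t. c - t \<partial>?M) = 0" using integral_nonneg_AE[OF nonneg] by simp
  then have "AE t in ?M. c - t = 0" using integral_nonneg_eq_0_iff_AE[OF int nonneg] by simp
  with AE have "AE t in ?M. False" by eventually_elim simp
  then have "emeasure ?M UNIV = 0" using AE_iff_measurable[of UNIV ?M "\<lambda>_. False"] by simp
  then have "S w = 0" using emeasure_scalar_norm[of UNIV "S w"] by simp
  then show ?thesis using S_eq_zero by (simp add: w_def)
qed

lemma E_lessThan_nonpos: "a \<le> 0 \<Longrightarrow> E {..<a} y = 0"
  using onorm_pos_le[OF bounded_linear_S] by (intro E_below_spectrum) (auto intro: order_trans)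

text \<open>Here \<open>T \<ge> a\<close>: bound the first moment of \<open>S w\<close>, which is
  \<open>w \<bullet> S w\<close>, from below by \<open>a ||S w||^2\<close> and from above by
  Cauchy-Schwarz.\<close>

lemma norm_S_le_of_atLeast:
  assumes w: "E {a..} w = w"
  shows "a * norm (S w) \<le> norm w"
proof -
  let ?M = "scalar_measure E (S w)"
  interpret M: finite_measure ?M by (rule finite_measure_scalar)
  have "E {a..} (S w) = S w" using w by (simp add: E_S_commute)
  then have AE: "AE t in ?M. a \<le> t" using AE_scalar[of "{a..}" "S w"] by simp
  have "a * (norm (S w))\<^sup>2 = (\<integral>t. a \<partial>?M)"
    using emeasure_scalar_norm[of UNIV "S w"] by (simp add: measure_def)
  also have "\<dots> \<le> (\<integral>t. t \<partial>?M)"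
    by (rule integral_mono_AE[OF _ dom_integrable[OF S_in_dom] AE]) simp
  also have "\<dots> = w \<bullet> S w" by (simp add: integral_scalar_S inner_S_self)
  also have "\<dots> \<le> norm w * norm (S w)" by (rule norm_cauchy_schwarz)
  finally show ?thesis by (cases "S w = 0") (auto simp: power2_eq_square)
qed

lemma atMost_mem_dom: 
  assumes "E {..b} w = w"
  shows "w \<in> dom"
proof (rule bounded_mem_dom)
  \<comment> \<open>The negative half-line carries no mass, so \<open>{..b}\<close> may be replaced
    by a bounded interval.\<close>
  have "{..b} = {..<0} \<inter> {..b} \<union> {0..b}" by auto
  then have "E {..b} w = E ({..<0} \<inter> {..b} \<union> {0..b}) w" by simp
  also have "\<dots> = E ({..<0} \<inter> {..b}) w + E {0..b} w" by (rule E_Un) auto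
  also have "E ({..<0} \<inter> {..b}) w = 0"
    by (subst E_Int) (auto simp: E_lessThan_nonpos)
  finally show "E {0..b} w = w" using assms by simp
qed auto

text \<open>The counterpart with \<open>T \<le> b\<close>: now \<open>w\<close> itself lies in
  \<open>dom\<close>, and the first moment of the cross measure of \<open>(S w, w)\<close> is
  \<open>||w||^2\<close>.\<close>

lemma norm_le_of_atMost:
  assumes w: "E {..b} w = w" 
  shows "norm w \<le> b * norm (S w)"
proof -
  let ?M = "cross_measure E (S w) w"
  interpret M: finite_measure ?M by (rule finite_measure_cross[OF inner_E_S_nonneg])
  have dom: "w \<in> dom" by (rule atMost_mem_dom[OF w])
  show ?thesis
  proof (cases "w = 0")
    case False
    have "b \<ge> 0"
    proof (rule ccontr)
      assume "\<not> b \<ge> 0"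
      then have "{..b} = {..<0} \<inter> {..b}" by auto
      then have "w = E {..<0} (E {..b} w)" using w by (metis E_Int atMost_borel lessThan_borel)
      then show False using False by (simp add: E_lessThan_nonpos)
    qed
    have "E {..b} (S w) = S w" using w by (simp add: E_S_commute)
    then have AE: "AE t in ?M. t \<le> b" using AE_cross[OF inner_E_S_nonneg, of "{..b}" w] by simp
    have "(norm w)\<^sup>2 = (\<integral>t. t \<partial>?M)" by (simp add: integral_cross_S dom)
    also have "\<dots> \<le> (\<integral>t. b \<partial>?M)"
      by (rule integral_mono_AE[OF integrable_cross_S[OF dom] _ AE]) simp
    also have "\<dots> = b * (S w \<bullet> w)"
      using inner_E_S_nonneg[of UNIV w] by (simp add: measure_def emeasure_cross[OF inner_E_S_nonneg])
    also have "\<dots> \<le> b * (norm (S w) * norm w)"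
      using \<open>b \<ge> 0\<close> by (intro mult_left_mono norm_cauchy_schwarz)
    finally show ?thesis using False by (auto simp: power2_eq_square)
  qed (simp add: S_zero)
qed

text \<open>The right-hand side does not mention \<open>E\<close>, so it pins down the spectral subspaces.\<close>

lemma atLeast_fixed_iff:
  assumes a: "a > 0"
  shows "E {a..} x = x \<longleftrightarrow> (\<forall>k. a ^ k * norm ((S ^^ k) x) \<le> norm x)"
proof safe
  fix k assume x: "E {a..} x = x"
  have fixed: "E {a..} ((S ^^ k) x) = (S ^^ k) x" for k
    by (induction k) (simp_all add: x E_S_commute)
  show "a ^ k * norm ((S ^^ k) x) \<le> norm x"
  proof (induction k)
    case (Suc k)
    have "a ^ Suc k * norm ((S ^^ Suc k) x) \<le> a ^ k * norm ((S ^^ k) x)"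
      using mult_left_mono[OF norm_S_le_of_atLeast[OF fixed, of k], of "a ^ k"] a by (simp add: mult_ac)
    with Suc show ?case by linarith
  qed simp
next
  assume growth: "\<forall>k. a ^ k * norm ((S ^^ k) x) \<le> norm x"
  \<comment> \<open>The part \<open>w\<close> of \<open>x\<close> below \<open>b\<close> satisfies
    \<open>||w|| \<le> b^k ||S^k w||\<close>, while the growth hypothesis bounds the right-hand side
    by \<open>(b/a)^k ||x||\<close>, which tends to zero.\<close>
  have zero: "E {..b} x = 0" if "b < a" for b
  proof (cases "b > 0")
    case False
    have "E {..b} (E {..b} x) = E {..b} x" by (simp add: E_idem)
    from norm_le_of_atMost[OF this] False show ?thesis 
      by (smt (verit) mult_nonneg_nonneg mult_minus_left norm_ge_zero norm_le_zero_iff)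
  next
    case True
    let ?w = "E {..b} x"
    have comm: "E {..b} ((S ^^ k) x) = (S ^^ k) ?w" for k
      by (induction k) (simp_all add: E_S_commute)
    have "norm ?w \<le> b ^ k * norm ((S ^^ k) ?w)" for k
    proof (induction k)
      case (Suc k)
      have "E {..b} ((S ^^ k) ?w) = (S ^^ k) ?w"
        by (simp add: comm[symmetric] E_idem)
      from mult_left_mono[OF norm_le_of_atMost[OF this], of "b ^ k"] True
      have "b ^ k * norm ((S ^^ k) ?w) \<le> b ^ Suc k * norm ((S ^^ Suc k) ?w)"
        by (simp add: mult_ac)
      with Suc show ?case by linarith
    qed simp
    also have "b ^ k * norm ((S ^^ k) ?w) \<le> (b / a) ^ k * norm x" for k
    proof -
      have "b ^ k * norm ((S ^^ k) ?w) \<le> b ^ k * norm ((S ^^ k) x)"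
        unfolding comm[symmetric] using True by (intro mult_left_mono norm_E_le) auto
      also have "\<dots> = (b / a) ^ k * (a ^ k * norm ((S ^^ k) x))" using a by (simp add: power_divide)
      also have "\<dots> \<le> (b / a) ^ k * norm x" using growth True a by (intro mult_left_mono) auto
      finally show ?thesis .
    qed
    finally have "norm ?w \<le> (b / a) ^ k * norm x" for k .
    moreover have "(\<lambda>k. (b / a) ^ k * norm x) \<longlonglongrightarrow> 0 * norm x"
      using True that a by (intro tendsto_intros LIMSEQ_power_zero) auto
    ultimately have "norm ?w \<le> 0 * norm x" by (intro LIMSEQ_le_const) auto
    then show ?thesis by simp
  qed
  \<comment> \<open>The decay needed \<open>b < a\<close> strictly; the open half-line is reached by
    countable exhaustion.\<close>
  have "(\<Union>n. {..a - inverse (real (Suc n))}) = {..<a}"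
    by (auto simp del: of_nat_Suc)
      (smt (verit) inverse_positive_iff_positive of_nat_0_less_iff zero_less_Suc,
       metis add.commute diff_gt_0_iff_gt le_diff_eq less_imp_le reals_Archimedean)
  moreover have "emeasure (scalar_measure E x) (\<Union>n. {..a - inverse (real (Suc n))}) = 0"
    by (rule emeasure_UN_eq_0) (auto simp: emeasure_scalar zero)
  ultimately have "E {..<a} x = 0" by (simp add: emeasure_scalar_norm)
  moreover have "E {..<a} x + E {a..} x = x"
    using E_Compl[of "{..<a}" x] by (simp add: Compl_lessThan)
  ultimately show "E {a..} x = x" by simp
qed

lemma atLeast_nonpos_fixed: "a \<le> 0 \<Longrightarrow> E {a..} x = x"
  using E_Compl[of "{..<a}" x] E_lessThan_nonpos[of a x] by (simp add: Compl_lessThan)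

text \<open>Both sides agree on \<open>{..b}\<close>, where \<open>integral_cross_S\<close> applies to \<open>E {..b} h\<close>.\<close>

lemma scalar_measure_eq_density:
  "scalar_measure E h = density (cross_measure E (S h) h) (\<lambda>t. ennreal t)"
proof (rule measure_eqI_generator_eq[where E="range (\<lambda>b::real. {..b})" and \<Omega>=UNIV and A="\<lambda>n::nat. {..real n}"])
  let ?N = "cross_measure E (S h) h"
  fix X assume "X \<in> range (\<lambda>b::real. {..b})"
  then obtain b where X: "X = {..b}" by auto
  define w where "w = E {..b} h"
  have w: "w \<in> dom" by (rule atMost_mem_dom[of b]) (simp add: w_def E_idem)
  \<comment> \<open>Cutting \<open>h\<close> down to \<open>w\<close> restricts the cross measure of
    \<open>(S h, h)\<close> to \<open>{..b}\<close>.\<close>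
  have w_E: "E B (S w) \<bullet> w = E (B \<inter> {..b}) (S h) \<bullet> h" if "B \<in> sets borel" for B
    using that unfolding w_def
    by (metis E_Int E_S_commute Int_commute Int_left_absorb atMost_borel sets.Int self_adjoint)
  have "cross_measure E (S w) w = density ?N (indicator {..b})"
    by (rule measure_eqI)
      (auto simp: emeasure_cross[OF inner_E_S_nonneg] w_E emeasure_density nn_integral_indicator'
         Int_commute simp flip: indicator_inter_arith)
  moreover have "(\<integral>\<^sup>+t. ennreal t \<partial>cross_measure E (S w) w) = ennreal ((norm w)\<^sup>2)"
  proof -
    \<comment> \<open>\<open>ennreal t\<close> truncates negative \<open>t\<close>, so the measure
      must first be seen to live on \<open>{0..}\<close>.\<close>
    have "E {..<0} (S w) = 0" by (simp add: E_lessThan_nonpos)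
    then have "E {0..} (S w) = S w" by (simp add: atLeast_nonpos_fixed)
    then have "AE t in cross_measure E (S w) w. 0 \<le> t"
      using AE_cross[OF inner_E_S_nonneg, of "{0..}" w] by simp
    from nn_integral_eq_integral[OF integrable_cross_S[OF w] this] show ?thesis
      by (simp add: integral_cross_S[OF w])
  qed
  ultimately have "(\<integral>\<^sup>+t. indicator {..b} t * ennreal t \<partial>?N) = ennreal ((norm w)\<^sup>2)"
    by (simp add: nn_integral_density)
  then show "emeasure (scalar_measure E h) X = emeasure (density ?N (\<lambda>t. ennreal t)) X"
    by (simp add: X w_def emeasure_scalar_norm emeasure_density mult.commute)
next
  show "(\<Union>n. {..real n}) = UNIV" using real_arch_simple by auto
next
  fix n :: nat
  show "emeasure (scalar_measure E h) {..real n} \<noteq> \<infinity>" by (simp add: emeasure_scalar)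
qed (auto simp: Int_stable_def borel_eq_atMost)

text \<open>The weight \<open>1/t\<close> cancels the density \<open>t\<close>, leaving at most the
  total mass of the cross measure.\<close>

lemma nn_integral_inverse:
  "(\<integral>\<^sup>+t. ennreal (inverse t) * indicator {0<..} t \<partial>scalar_measure E h) \<le> ennreal ((norm (A h))\<^sup>2)"
proof -
  have "(\<integral>\<^sup>+t. ennreal (inverse t) * indicator {0<..} t \<partial>scalar_measure E h)
     = (\<integral>\<^sup>+t. ennreal t * (ennreal (inverse t) * indicator {0<..} t) \<partial>cross_measure E (S h) h)"
    by (simp add: scalar_measure_eq_density nn_integral_density)
  also have "\<dots> \<le> (\<integral>\<^sup>+t. 1 \<partial>cross_measure E (S h) h)"
    by (intro nn_integral_mono) (auto simp: indicator_def simp flip: ennreal_mult)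
  also have "\<dots> = ennreal ((norm (A h))\<^sup>2)"
    using emeasure_cross[OF inner_E_S_nonneg, of UNIV h] inner_E_S[of UNIV h] by simp
  finally show ?thesis .
qed

end

section \<open>Uniqueness of the scalar spectral measures\<close>

text \<open>By \<open>atLeast_fixed_iff\<close> the projections of closed upper half-lines have the
  same ranges for \<open>E\<close> and \<open>F\<close>, and these half-lines generate the Borel
  sets.\<close>

lemma scalar_measure_unique:
  fixes A :: "'a::{real_inner, banach} \<Rightarrow> 'b::real_inner"
  assumes "spectral_measure_of_generator E A" "spectral_measure_of_generator F A"
  shows "scalar_measure E x = scalar_measure F x"
proof -
  interpret E: spectral_measure_of_generator E A by fact
  interpret F: spectral_measure_of_generator F A by fact
  have fixed: "E {a..} z = z \<longleftrightarrow> F {a..} z = z" for a z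
    using E.atLeast_fixed_iff[of a z] F.atLeast_fixed_iff[of a z]
      E.atLeast_nonpos_fixed[of a z] F.atLeast_nonpos_fixed[of a z]
    by (cases "a > 0") (auto simp: E.S_def[abs_def] F.S_def[abs_def])
  have eq: "E {a..} x = F {a..} x" for a
  \<comment> \<open>Self-adjoint \<open>P\<close> and \<open>Q\<close> with \<open>Q P = P\<close>
    and \<open>P Q = Q\<close> coincide.\<close>
  proof (subst vector_eq_rdot[symmetric], rule allI)
    fix y
    have "F {a..} (E {a..} x) = E {a..} x" "E {a..} (F {a..} y) = F {a..} y"
      using fixed[of a "E {a..} x"] fixed[of a "F {a..} y"] by (simp_all add: E.E_idem F.E_idem)
    then show "E {a..} x \<bullet> y = F {a..} x \<bullet> y"
      by (metis E.self_adjoint F.self_adjoint atLeast_borel)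
  qed
  show ?thesis
  proof (rule measure_eqI_generator_eq[where E="range (\<lambda>b::real. {b..})" and \<Omega>=UNIV and A="\<lambda>n::nat. {- real n..}"])
    show "(\<Union>n. {- real n..}) = UNIV"
    proof (safe, simp_all)
      fix t :: real
      obtain n where "- t \<le> real n" using real_arch_simple by blast
      then show "\<exists>n. - real n \<le> t" by (intro exI[of _ n]) simp
    qed
    show "emeasure (scalar_measure E x) {- real n..} \<noteq> \<infinity>" for n by (simp add: E.emeasure_scalar)
    show "emeasure (scalar_measure E x) X = emeasure (scalar_measure F x) X" if "X \<in> range atLeast" for X
      using that eq by (auto simp: E.emeasure_scalar F.emeasure_scalar)
  qed (auto simp: Int_stable_def borel_Ici intro: range_eqI[of _ _ "max _ _"])
qed

subsection \<open>The interpolation inequality\<close>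

lemma spectral_measure_of_generatorI:
  "bounded_linear A \<Longrightarrow> inj A \<Longrightarrow> is_spectral_measure (scale_generator A) E \<Longrightarrow>
    spectral_measure_of_generator E A"
  by (simp add: is_spectral_measure_def spectral_measure_of_generator_def pvm_def
    spectral_measure_of_generator_axioms_def)

context spectral_measure_of_generator
begin

abbreviation half_line_integral :: "(real \<Rightarrow> real) \<Rightarrow> 'a \<Rightarrow> ennreal" where
  "half_line_integral \<phi> h \<equiv> (\<integral>\<^sup>+t. ennreal (\<phi> t) * indicator {0<..} t \<partial>scalar_measure E h)"

text \<open>The case \<open>b = 0\<close> of \<open>norm_le_of_atMost\<close>; hence restricting
  integrals to \<open>{0<..}\<close> loses no mass.\<close>

lemma E_positive: "E {0<..} h = h"
proof -
  have "norm (E {..0} h) \<le> 0 * norm (S (E {..0} h))"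
    by (rule norm_le_of_atMost) (simp add: E_idem)
  then show ?thesis using E_Compl[of "{..0}" h] by (simp add: Compl_atMost)
qed

lemma borel_measurable_half_line [measurable]:
  fixes \<phi> :: "real \<Rightarrow> real"
  shows "continuous_on {0<..} \<phi> \<Longrightarrow> (\<lambda>t. ennreal (\<phi> t) * indicator {0<..} t) \<in> borel_measurable borel"
proof -
  assume "continuous_on {0<..} \<phi>"
  then have "(\<lambda>t. indicator {0<..} t *\<^sub>R \<phi> t) \<in> borel_measurable borel"
    by (intro borel_measurable_continuous_on_indicator) auto
  then have "(\<lambda>t. ennreal (indicator {0<..} t *\<^sub>R \<phi> t)) \<in> borel_measurable borel" by simp
  then show ?thesis by (rule measurable_cong[THEN iffD1, rotated]) (auto simp: indicator_def)
qed

text \<open>The triangle inequality of the scale norm, stated without square roots for integrals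
  that may a priori be infinite.\<close>

lemma half_line_integral_diff_le:
  assumes cont: "continuous_on {0<..} \<phi>" and "R1 > 0" "R2 > 0"
    and x: "half_line_integral \<phi> x \<le> ennreal (R1\<^sup>2)" and y: "half_line_integral \<phi> y \<le> ennreal (R2\<^sup>2)"
  shows "half_line_integral \<phi> (x - y) \<le> ennreal ((R1 + R2)\<^sup>2)"
proof -
  \<comment> \<open>The minimiser of \<open>(1 + a) R1^2 + (1 + 1/a) R2^2\<close>, with minimum
    \<open>(R1 + R2)^2\<close>.\<close>
  define a where "a = R2 / R1"
  have a: "a > 0" using assms by (simp add: a_def)
  have "1 * half_line_integral \<phi> (x - y) + 0 * half_line_integral \<phi> (x - y)
      \<le> ennreal (1 + a) * half_line_integral \<phi> x + ennreal (1 + 1 / a) * half_line_integral \<phi> y"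
    using inner_E_diff_le[OF a] a
    by (intro nn_integral_comparison borel_measurable_half_line cont)
      (auto simp: emeasure_scalar inner_E_nonneg simp del: ennreal_plus
        simp flip: ennreal_mult ennreal_plus intro!: ennreal_leI)
  also have "\<dots> \<le> ennreal (1 + a) * ennreal (R1\<^sup>2) + ennreal (1 + 1 / a) * ennreal (R2\<^sup>2)"
    by (intro add_mono mult_left_mono x y) auto
  also have "\<dots> = ennreal ((1 + a) * R1\<^sup>2 + (1 + 1 / a) * R2\<^sup>2)"
    using a by (simp del: ennreal_plus flip: ennreal_mult ennreal_plus)
  also have "(1 + a) * R1\<^sup>2 + (1 + 1 / a) * R2\<^sup>2 = (R1 + R2)\<^sup>2"
    using assms by (simp add: a_def power2_eq_square field_simps)
  finally show ?thesis by simp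
qed

text \<open>
  Jensen's inequality in tangent form: with slope \<open>m\<close> of \<open>\<Psi>\<close> at \<open>u = (r / s)\<^sup>2\<close> the hypothesis gives
  \<open>1 \<le> (\<Psi> u - m u) / t + m \<phi> t\<close> on the spectrum, and both coefficients are nonnegative.
\<close>

lemma interpolation_inequality:
  assumes conc: "concave_on {0<..} \<Psi>" and pos: "\<And>t. t > 0 \<Longrightarrow> \<Psi> t > 0"
    and cont: "continuous_on {0<..} \<phi>" and \<phi>_pos: "\<And>t. t > 0 \<Longrightarrow> \<phi> t > 0"
    and le: "\<And>t. t \<ge> inverse (onorm S) \<Longrightarrow> t \<le> \<Psi> (\<phi> t * t)"
    and "r > 0" "s > 0" and r: "half_line_integral \<phi> h \<le> ennreal (r\<^sup>2)" and s: "norm (A h) \<le> s"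
  shows "norm h \<le> s * sqrt (\<Psi> ((r / s)\<^sup>2))"
proof -
  define u where "u = (r / s)\<^sup>2"
  have u: "u > 0" using assms by (simp add: u_def)
  obtain m where m: "m \<ge> 0" "m * u \<le> \<Psi> u" "\<And>v. v > 0 \<Longrightarrow> \<Psi> v \<le> \<Psi> u + m * (v - u)"
    using concave_tangent[OF conc pos u] by metis
  let ?M = "scalar_measure E h"
  let ?inv = "\<lambda>t::real. ennreal (inverse t) * indicator {0<..} t"
    and ?phi = "\<lambda>t. ennreal (\<phi> t) * indicator {0<..} t"
  have "E {inverse (onorm S)..} h = h"
    using E_Compl[of "{..<inverse (onorm S)}" h] by (simp add: Compl_lessThan E_below_spectrum)
  then have "AE t in ?M. t \<in> {inverse (onorm S)..}" by (intro AE_scalar) auto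
  moreover have "AE t in ?M. t \<in> {0<..}" by (intro AE_scalar E_positive) auto
  ultimately have AE: "AE t in ?M. 1 \<le> ennreal (\<Psi> u - m * u) * ?inv t + ennreal m * ?phi t"
  proof eventually_elim
    case (elim t)
    then have t: "t > 0" "\<phi> t > 0" using \<phi>_pos by auto
    have "t \<le> \<Psi> u + m * (\<phi> t * t - u)"
      using le[of t] m(3)[of "\<phi> t * t"] t elim by simp
    then have "1 \<le> (\<Psi> u - m * u) * inverse t + m * \<phi> t"
      using t by (simp add: field_simps)
    then have "ennreal 1 \<le> ennreal ((\<Psi> u - m * u) * inverse t + m * \<phi> t)" by (rule ennreal_leI)
    then show ?case using t m by (simp add: ennreal_mult)
  qed
  have "ennreal ((norm h)\<^sup>2) = (\<integral>\<^sup>+t. 1 \<partial>?M)"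
    using emeasure_scalar_norm[of UNIV h] by simp
  also have "\<dots> \<le> (\<integral>\<^sup>+t. ennreal (\<Psi> u - m * u) * ?inv t + ennreal m * ?phi t \<partial>?M)"
    by (rule nn_integral_mono_AE[OF AE])
  also have "\<dots> = ennreal (\<Psi> u - m * u) * (\<integral>\<^sup>+t. ?inv t \<partial>?M) + ennreal m * (\<integral>\<^sup>+t. ?phi t \<partial>?M)"
    using cont by (simp add: nn_integral_add nn_integral_cmult)
  also have "\<dots> \<le> ennreal (\<Psi> u - m * u) * ennreal (s\<^sup>2) + ennreal m * ennreal (r\<^sup>2)"
    using s by (intro add_mono mult_left_mono r order_trans[OF nn_integral_inverse]) (auto intro!: ennreal_leI power_mono)
  also have "\<dots> = ennreal ((\<Psi> u - m * u) * s\<^sup>2 + m * r\<^sup>2)"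
    using m by (simp add: ennreal_mult)
  \<comment> \<open>Since \<open>u s^2 = r^2\<close>, the terms with the unknown slope
    \<open>m\<close> cancel.\<close>
  also have "(\<Psi> u - m * u) * s\<^sup>2 + m * r\<^sup>2 = s\<^sup>2 * \<Psi> u"
    using \<open>s > 0\<close> by (simp add: u_def power_divide algebra_simps)
  finally have "(norm h)\<^sup>2 \<le> s\<^sup>2 * \<Psi> u"
    using pos[OF u] by simp
  then have "norm h \<le> sqrt (s\<^sup>2 * \<Psi> u)" by (rule real_le_rsqrt)
  then show ?thesis using \<open>s > 0\<close> by (simp add: real_sqrt_mult u_def)
qed

text \<open>By \<open>scalar_measure_unique\<close> every form value of \<open>h\<close> equals the
  integral against the fixed \<open>E\<close>, so the description in \<open>scale_norm\<close>
  denotes that integral.\<close>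

lemma scale_ball_half_line_integral:
  assumes pos: "\<And>t. t > 0 \<Longrightarrow> \<phi> t > 0" and h: "h \<in> scale_ball (scale_generator A) \<phi> R"
  shows "half_line_integral \<phi> h \<le> ennreal (R\<^sup>2)"
proof -
  let ?M = "scalar_measure E h"
  define q where "q = (LINT t:{0<..}|?M. \<phi> t)"
  have unique: "set_integrable ?M {0<..} \<phi> \<and> q' = q" if "has_form_value (scale_generator A) \<phi> h q'" for q'
  proof -
    from that obtain F where F: "is_spectral_measure (scale_generator A) F"
      "set_integrable (scalar_measure F h) {0<..} \<phi>" "q' = (LINT t:{0<..}|scalar_measure F h. \<phi> t)"
      by (auto simp: has_form_value_def)
    have "spectral_measure_of_generator F A"
      by (rule spectral_measure_of_generatorI[OF A inj_A F(1)])
    from scalar_measure_unique[OF this spectral_measure_of_generator_axioms] F(2,3)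
    show ?thesis by (simp add: q_def)
  qed
  obtain q0 where q0: "has_form_value (scale_generator A) \<phi> h q0"
    using h by (auto simp: scale_ball_def scale_space_def)
  have int: "set_integrable ?M {0<..} \<phi>" using unique[OF q0] by simp
  have "(THE q'. has_form_value (scale_generator A) \<phi> h q') = q"
    using q0 unique by (intro the_equality) blast+
  then have "sqrt q \<le> R" using h by (simp add: scale_ball_def scale_norm_def)
  then have "q \<le> R\<^sup>2" by (rule sqrt_le_D)
  have "half_line_integral \<phi> h = (\<integral>\<^sup>+t. ennreal (indicator {0<..} t *\<^sub>R \<phi> t) \<partial>?M)"
    by (intro nn_integral_cong) (auto simp: indicator_def)
  also have "\<dots> = ennreal q"
    using int unfolding q_def set_lebesgue_integral_def set_integrable_def
    by (intro nn_integral_eq_integral) (auto simp: indicator_def pos less_imp_le)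
  also have "\<dots> \<le> ennreal (R\<^sup>2)" by (rule ennreal_leI) fact
  finally show ?thesis .
qed

end

theorem corollary2p8:
  fixes A :: "'a::{real_inner, banach, second_countable_topology} \<Rightarrow>
              'b::{real_inner, banach, second_countable_topology}"
    and chi \<Psi> \<xi> :: "real \<Rightarrow> real"
    and f :: 'a and g :: 'b
    and reg :: "real \<Rightarrow> 'b \<Rightarrow> 'a"
    and \<alpha> :: "real \<Rightarrow> 'b \<Rightarrow> real"
    and R1 R2 C \<delta>max :: real
  assumes "infinite_dimensional TYPE('a)" and "infinite_dimensional TYPE('b)"
    and "bounded_linear A" and "inj A" and "\<not> closed (range A)"
    and "index_function chi" and "index_function \<Psi>" and "concave_on {0<..} \<Psi>"
    and "\<And>t. t \<ge> inverse (onorm (\<lambda>x. adjoint A (A x))) \<Longrightarrow> \<Psi> (chi t * t) \<ge> t"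
    and "((\<lambda>t. \<Psi> t / t) \<longlongrightarrow> 0) at_top"
    and "A f = g" and "R1 > 0" and "f \<in> scale_ball (scale_generator A) chi R1"
    and "\<delta>max > 0" and "R2 > 0" and "C > 0"
    and "rate_function_on {0<..\<delta>max} \<xi>"
    and "\<And>\<delta> g\<delta>. 0 < \<delta> \<Longrightarrow> \<delta> \<le> \<delta>max \<Longrightarrow> norm (g - g\<delta>) \<le> \<delta> \<Longrightarrow>
           \<alpha> \<delta> g\<delta> > 0 \<and>
           reg (\<alpha> \<delta> g\<delta>) g\<delta> \<in> scale_ball (scale_generator A) chi R2 \<and>
           norm (A (reg (\<alpha> \<delta> g\<delta>) g\<delta>) - g) \<le> C * \<xi> \<delta>"
  shows "(\<forall>\<delta> g\<delta>. 0 < \<delta> \<and> \<delta> \<le> \<delta>max \<and> norm (g - g\<delta>) \<le> \<delta> \<longrightarrow>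
            norm (f - reg (\<alpha> \<delta> g\<delta>) g\<delta>)
              \<le> C * \<xi> \<delta> * sqrt (\<Psi> (((R1 + R2) / (C * \<xi> \<delta>))\<^sup>2))) \<and>
         rate_function_on {0<..\<delta>max}
           (\<lambda>\<delta>. C * \<xi> \<delta> * sqrt (\<Psi> (((R1 + R2) / (C * \<xi> \<delta>))\<^sup>2)))"
proof (intro conjI allI impI)
  show "rate_function_on {0<..\<delta>max} (\<lambda>\<delta>. C * \<xi> \<delta> * sqrt (\<Psi> (((R1 + R2) / (C * \<xi> \<delta>))\<^sup>2)))"
    using assms by (intro rate_function_concave_bound) auto
next
  fix \<delta> :: real and g\<delta> :: 'b
  assume \<delta>: "0 < \<delta> \<and> \<delta> \<le> \<delta>max \<and> norm (g - g\<delta>) \<le> \<delta>"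
  define h where "h = reg (\<alpha> \<delta> g\<delta>) g\<delta>"
  have h: "h \<in> scale_ball (scale_generator A) chi R2" "norm (A h - g) \<le> C * \<xi> \<delta>"
    using assms(18)[of \<delta> g\<delta>] \<delta> by (auto simp: h_def)
  \<comment> \<open>Membership of \<open>f\<close> in the ball already contains the existence of a
    spectral measure, so the spectral theorem is not invoked.\<close>
  obtain E where "is_spectral_measure (scale_generator A) E"
    using assms(13) by (auto simp: scale_ball_def scale_space_def has_form_value_def)
  then interpret spectral_measure_of_generator E A
    using assms(3,4) by (intro spectral_measure_of_generatorI)
  have chi: "continuous_on {0<..} chi" "\<And>t. t > 0 \<Longrightarrow> chi t > 0"
    using assms(6) by (auto simp: index_function_def)
  have "norm (f - h) \<le> C * \<xi> \<delta> * sqrt (\<Psi> (((R1 + R2) / (C * \<xi> \<delta>))\<^sup>2))"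
  proof (rule interpolation_inequality)
    show "half_line_integral chi (f - h) \<le> ennreal ((R1 + R2)\<^sup>2)"
      by (intro half_line_integral_diff_le chi scale_ball_half_line_integral assms(12,13,15) h)
    show "norm (A (f - h)) \<le> C * \<xi> \<delta>"
      using h(2) assms(11) by (simp add: linear_diff[OF bounded_linear.linear[OF A]] norm_minus_commute)
    show "0 < C * \<xi> \<delta>" using assms(16,17) \<delta> by (simp add: rate_function_on_def)
    show "t \<le> \<Psi> (chi t * t)" if "t \<ge> inverse (onorm S)" for t
      using assms(9) that by (simp add: S_def[abs_def])
    show "\<Psi> t > 0" if "t > 0" for t using assms(7) that by (simp add: index_function_def)
  qed (use assms(8,12,15) chi in auto)
  then show "norm (f - reg (\<alpha> \<delta> g\<delta>) g\<delta>) \<le> C * \<xi> \<delta> * sqrt (\<Psi> (((R1 + R2) / (C * \<xi> \<delta>))\<^sup>2))"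
    by (simp add: h_def)
qed

end
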